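(* Let $(M,\mu)$ be a probability space and let $p>1$, $p\neq 2$. Let $S\subset L_{p}(M,d\mu)$ be a linear subspace, closed in $L_p(M,d\mu)$, which is embedded into $L_{\infty}(M,d\mu)$. Then there is a finite constant $K_{p,\infty}>0$ such that the dimension of $S$ satisfies $\dim S\leq K_{p,\infty}^{2}$; in particular $\dim S=N$ is finite.
   Context: $L_r(M,d\mu)$ denotes the Banach space of (classes of) real-valued functions with norm $\|\cdot\|_r$. "$S$ is embedded into $L_\infty(M,d\mu)$" means that every $f\in S$ belongs to $L_\infty(M,d\mu)$. *)

theory Defs
  imports "HOL-Probability.Probability" "Jordan_Normal_Form.VS_Connect"
begin

definition ae_class :: "'a measure \<Rightarrow> ('a \<Rightarrow> real) \<Rightarrow> ('a \<Rightarrow> real) set" where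
  "ae_class M f = {g \<in> borel_measurable M. AE x in M. f x = g x}"

definition rep :: "('a \<Rightarrow> real) set \<Rightarrow> 'a \<Rightarrow> real" where
  "rep u = (SOME f. f \<in> u)"

text \<open>
  The vector space \<open>L\<^sub>p(M)\<close> of AE-classes as a module record over \<open>class_ring\<close> (the field of
  real numbers). The fields \<open>mult\<close> and \<open>one\<close> are only there because the record type
  \<open>module\<close> extends \<open>ring\<close>; they play no role in \<open>vectorspace\<close>.
\<close>

definition Lp :: "'a measure \<Rightarrow> real \<Rightarrow> (real, ('a \<Rightarrow> real) set) module" where
  "Lp M p =
    \<lparr> carrier = {ae_class M f | f.
          f \<in> borel_measurable M \<and> integrable M (\<lambda>x. \<bar>f x\<bar> powr p)},
      mult = undefined,
      one = undefined,
      zero = ae_class M (\<lambda>x. 0),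
      add = (\<lambda>u v. ae_class M (\<lambda>x. rep u x + rep v x)),
      smult = (\<lambda>c u. ae_class M (\<lambda>x. c * rep u x)) \<rparr>"

definition Lp_norm :: "'a measure \<Rightarrow> real \<Rightarrow> ('a \<Rightarrow> real) set \<Rightarrow> real" where
  "Lp_norm M p u = (\<integral>x. \<bar>rep u x\<bar> powr p \<partial>M) powr (1 / p)"

text \<open>
  The locale \<open>Metric_space\<close> demands symmetry on the whole type, hence the value \<open>0\<close>
  off the carrier.
\<close>

definition Lp_dist :: "'a measure \<Rightarrow> real \<Rightarrow> ('a \<Rightarrow> real) set \<Rightarrow> ('a \<Rightarrow> real) set \<Rightarrow> real" where
  "Lp_dist M p u v =
    (if u \<in> carrier (Lp M p) \<and> v \<in> carrier (Lp M p) then Lp_norm M p (u \<ominus>\<^bsub>Lp M p\<^esub> v) else 0)"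

definition Lp_topology :: "'a measure \<Rightarrow> real \<Rightarrow> ('a \<Rightarrow> real) set topology" where
  "Lp_topology M p = Metric_space.mtopology (carrier (Lp M p)) (Lp_dist M p)"

definition Linf :: "'a measure \<Rightarrow> ('a \<Rightarrow> real) set set" where
  "Linf M = {ae_class M f | f. f \<in> borel_measurable M \<and> (\<exists>C. AE x in M. \<bar>f x\<bar> \<le> C)}"

text \<open>Well-definedness: \<open>L\<^sub>p(M)\<close> is a vector space and its norm induces a metric.\<close>

lemma ae_class_eq:
  assumes "AE x in M. f x = g x"
  shows "ae_class M f = ae_class M g"
  unfolding ae_class_def using assms by (auto elim: eventually_elim2)

lemma rep_ae_class:
  assumes "f \<in> borel_measurable M"
  shows "rep (ae_class M f) \<in> borel_measurable M" "AE x in M. rep (ae_class M f) x = f x"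
proof -
  have "f \<in> ae_class M f" using assms by (simp add: ae_class_def)
  hence "rep (ae_class M f) \<in> ae_class M f" unfolding rep_def
    by (rule someI[where P = "\<lambda>h. h \<in> ae_class M f"])
  thus "rep (ae_class M f) \<in> borel_measurable M" "AE x in M. rep (ae_class M f) x = f x"
    by (auto simp: ae_class_def eq_commute)
qed

lemma abs_add_powr_le:
  fixes a b :: real
  assumes "p > 0"
  shows "\<bar>a + b\<bar> powr p \<le> 2 powr p * (\<bar>a\<bar> powr p + \<bar>b\<bar> powr p)"
proof -
  have "\<bar>a + b\<bar> powr p \<le> (2 * max \<bar>a\<bar> \<bar>b\<bar>) powr p"
    using assms by (intro powr_mono2) auto
  also have "\<dots> = 2 powr p * (max \<bar>a\<bar> \<bar>b\<bar>) powr p"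
    by (simp add: powr_mult)
  also have "\<dots> \<le> 2 powr p * (\<bar>a\<bar> powr p + \<bar>b\<bar> powr p)"
    by (intro mult_left_mono) (auto simp: max_def)
  finally show ?thesis .
qed

lemma integrable_add_powr:
  fixes f g :: "'a \<Rightarrow> real"
  assumes "p > 0" "f \<in> borel_measurable M" "g \<in> borel_measurable M"
    "integrable M (\<lambda>x. \<bar>f x\<bar> powr p)" "integrable M (\<lambda>x. \<bar>g x\<bar> powr p)"
  shows "integrable M (\<lambda>x. \<bar>f x + g x\<bar> powr p)"
proof (rule Bochner_Integration.integrable_bound)
  show "integrable M (\<lambda>x. 2 powr p * (\<bar>f x\<bar> powr p + \<bar>g x\<bar> powr p))"
    using assms by simp
  show "(\<lambda>x. \<bar>f x + g x\<bar> powr p) \<in> borel_measurable M" using assms by measurable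
  show "AE x in M. norm (\<bar>f x + g x\<bar> powr p) \<le> norm (2 powr p * (\<bar>f x\<bar> powr p + \<bar>g x\<bar> powr p))"
    using abs_add_powr_le[OF assms(1)] by (intro AE_I2) (auto simp: abs_mult)
qed

lemma integrable_cmult_powr:
  fixes f :: "'a \<Rightarrow> real"
  assumes "integrable M (\<lambda>x. \<bar>f x\<bar> powr p)"
  shows "integrable M (\<lambda>x. \<bar>c * f x\<bar> powr p)"
  using assms by (simp add: abs_mult powr_mult)

lemma Lp_add_class:
  assumes "f \<in> borel_measurable M" "g \<in> borel_measurable M"
  shows "ae_class M f \<oplus>\<^bsub>Lp M p\<^esub> ae_class M g = ae_class M (\<lambda>x. f x + g x)"
proof -
  have "AE x in M. rep (ae_class M f) x + rep (ae_class M g) x = f x + g x"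
    using rep_ae_class(2)[OF assms(1)] rep_ae_class(2)[OF assms(2)] by eventually_elim simp
  thus ?thesis by (simp add: Lp_def ae_class_eq)
qed

lemma Lp_smult_class:
  assumes "f \<in> borel_measurable M"
  shows "c \<odot>\<^bsub>Lp M p\<^esub> ae_class M f = ae_class M (\<lambda>x. c * f x)"
proof -
  have "AE x in M. c * rep (ae_class M f) x = c * f x"
    using rep_ae_class(2)[OF assms(1)] by eventually_elim simp
  thus ?thesis by (simp add: Lp_def ae_class_eq)
qed

lemma Lp_zero: "\<zero>\<^bsub>Lp M p\<^esub> = ae_class M (\<lambda>x. 0)"
  by (simp add: Lp_def)

lemma Lp_carrierI:
  assumes "f \<in> borel_measurable M" "integrable M (\<lambda>x. \<bar>f x\<bar> powr p)"
  shows "ae_class M f \<in> carrier (Lp M p)"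
  using assms by (auto simp: Lp_def)

lemma Lp_carrierE:
  assumes "u \<in> carrier (Lp M p)"
  obtains f where "u = ae_class M f" "f \<in> borel_measurable M" "integrable M (\<lambda>x. \<bar>f x\<bar> powr p)"
  using assms by (auto simp: Lp_def)

lemma vectorspace_Lp:
  assumes p: "p > 0"
  shows "vectorspace class_ring (Lp M p)"
proof (rule vs_criteria)
  show "field (class_ring :: real ring)" by (rule class_field.field_axioms)
  show "\<zero>\<^bsub>Lp M p\<^esub> \<in> carrier (Lp M p)"
    unfolding Lp_zero by (rule Lp_carrierI) auto
  show "\<forall>v w. v \<in> carrier (Lp M p) \<and> w \<in> carrier (Lp M p) \<longrightarrow>
      v \<oplus>\<^bsub>Lp M p\<^esub> w \<in> carrier (Lp M p)"
  proof (intro allI impI, elim conjE Lp_carrierE)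
    fix v w f g
    assume "v = ae_class M f" "w = ae_class M g"
      and m: "f \<in> borel_measurable M" "g \<in> borel_measurable M"
      and i: "integrable M (\<lambda>x. \<bar>f x\<bar> powr p)" "integrable M (\<lambda>x. \<bar>g x\<bar> powr p)"
    thus "v \<oplus>\<^bsub>Lp M p\<^esub> w \<in> carrier (Lp M p)"
      using integrable_add_powr[OF p m i] by (simp add: Lp_add_class Lp_carrierI)
  qed
  show "\<forall>v\<in>carrier (Lp M p). \<exists>neg_v\<in>carrier (Lp M p). v \<oplus>\<^bsub>Lp M p\<^esub> neg_v = \<zero>\<^bsub>Lp M p\<^esub>"
  proof (intro ballI, elim Lp_carrierE)
    fix v f
    assume "v = ae_class M f" "f \<in> borel_measurable M" "integrable M (\<lambda>x. \<bar>f x\<bar> powr p)"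
    thus "\<exists>neg_v\<in>carrier (Lp M p). v \<oplus>\<^bsub>Lp M p\<^esub> neg_v = \<zero>\<^bsub>Lp M p\<^esub>"
      by (intro bexI[of _ "ae_class M (\<lambda>x. - f x)"]) (auto simp: Lp_add_class Lp_zero intro: Lp_carrierI)
  qed
  show "\<forall>c v. c \<in> carrier class_ring \<and> v \<in> carrier (Lp M p) \<longrightarrow>
      c \<odot>\<^bsub>Lp M p\<^esub> v \<in> carrier (Lp M p)"
    by (auto elim!: Lp_carrierE simp: Lp_smult_class intro!: Lp_carrierI integrable_cmult_powr)
qed (auto elim!: Lp_carrierE simp: Lp_add_class Lp_smult_class Lp_zero algebra_simps)

lemma Lp_minus_class:
  assumes p: "p > 0" and "f \<in> borel_measurable M" "g \<in> borel_measurable M"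
    "integrable M (\<lambda>x. \<bar>f x\<bar> powr p)" "integrable M (\<lambda>x. \<bar>g x\<bar> powr p)"
  shows "ae_class M f \<ominus>\<^bsub>Lp M p\<^esub> ae_class M g = ae_class M (\<lambda>x. f x - g x)"
proof -
  interpret vectorspace class_ring "Lp M p" by (rule vectorspace_Lp[OF p])
  have "\<ominus>\<^bsub>Lp M p\<^esub> ae_class M g = ae_class M (\<lambda>x. - g x)"
    using assms by (intro M.minus_equality) (auto simp: Lp_add_class Lp_zero intro!: Lp_carrierI)
  thus ?thesis using assms by (simp add: a_minus_def Lp_add_class)
qed

lemma Lp_norm_class:
  assumes "f \<in> borel_measurable M"
  shows "Lp_norm M p (ae_class M f) = (\<integral>x. \<bar>f x\<bar> powr p \<partial>M) powr (1 / p)"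
proof -
  have "(\<integral>x. \<bar>rep (ae_class M f) x\<bar> powr p \<partial>M) = (\<integral>x. \<bar>f x\<bar> powr p \<partial>M)"
    using rep_ae_class[OF assms] assms
    by (intro integral_cong_AE) (auto elim: eventually_mono)
  thus ?thesis by (simp add: Lp_norm_def)
qed

lemma convex_powr_le:
  fixes a b t p :: real
  assumes "p \<ge> 1" "0 \<le> a" "0 \<le> b" "0 < t" "t < 1"
  shows "(t * a + (1 - t) * b) powr p \<le> t * a powr p + (1 - t) * b powr p"
proof -
  have pow: "s powr p \<le> s" if "0 < s" "s < 1" for s :: real
    using powr_mono'[of 1 p s] that assms by simp
  consider "a = 0" | "b = 0" | "a > 0" "b > 0" using assms by linarith
  thus ?thesis
  proof cases
    case 1
    thus ?thesis using pow[of "1 - t"] assms by (simp add: powr_mult mult_right_mono)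
  next
    case 2
    thus ?thesis using pow[of t] assms by (simp add: powr_mult mult_right_mono)
  next
    case 3
    thus ?thesis
      using convex_onD[OF powr_convex[OF assms(1)], of "1 - t" a b] assms by simp
  qed
qed

lemma Minkowski:
  fixes f g :: "'a \<Rightarrow> real"
  assumes p: "p \<ge> 1" and m: "f \<in> borel_measurable M" "g \<in> borel_measurable M"
    and i: "integrable M (\<lambda>x. \<bar>f x\<bar> powr p)" "integrable M (\<lambda>x. \<bar>g x\<bar> powr p)"
  shows "(\<integral>x. \<bar>f x + g x\<bar> powr p \<partial>M) powr (1 / p)
    \<le> (\<integral>x. \<bar>f x\<bar> powr p \<partial>M) powr (1 / p) + (\<integral>x. \<bar>g x\<bar> powr p \<partial>M) powr (1 / p)"
    (is "?L \<le> ?A + ?B")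
proof -
  have null: "AE x in M. h x = 0"
    if "(\<integral>x. \<bar>h x\<bar> powr p \<partial>M) powr (1 / p) = 0" "integrable M (\<lambda>x. \<bar>h x\<bar> powr p)"
    for h :: "'a \<Rightarrow> real"
    using that integral_nonneg_eq_0_iff_AE[OF that(2)] by simp
  consider "?A = 0" | "?B = 0" | "?A > 0" "?B > 0"
    by (metis less_eq_real_def powr_ge_zero)
  thus ?thesis
  proof cases
    case 1
    have "(\<integral>x. \<bar>f x + g x\<bar> powr p \<partial>M) = (\<integral>x. \<bar>g x\<bar> powr p \<partial>M)"
      using null[OF 1 i(1)] m by (intro integral_cong_AE) (auto elim: eventually_mono)
    thus ?thesis using 1 by simp
  next
    case 2
    have "(\<integral>x. \<bar>f x + g x\<bar> powr p \<partial>M) = (\<integral>x. \<bar>f x\<bar> powr p \<partial>M)"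
      using null[OF 2 i(2)] m by (intro integral_cong_AE) (auto elim: eventually_mono)
    thus ?thesis using 2 by simp
  next
    case 3
    define A B where "A = ?A" and "B = ?B"
    have pos: "A > 0" "B > 0" using 3 by (auto simp: A_def B_def)
    define t where "t = A / (A + B)"
    have t: "0 < t" "t < 1" using pos by (auto simp: t_def)
    have Ap: "(\<integral>x. \<bar>f x\<bar> powr p \<partial>M) = A powr p" "(\<integral>x. \<bar>g x\<bar> powr p \<partial>M) = B powr p"
      using p by (auto simp: A_def B_def powr_powr)
    have le: "\<bar>f x + g x\<bar> powr p \<le> (A + B) powr p *
        (t * (\<bar>f x\<bar> powr p / A powr p) + (1 - t) * (\<bar>g x\<bar> powr p / B powr p))" for x
    proof -
      have t': "(A + B) * t = A" "(A + B) * (1 - t) = B"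
        using pos by (auto simp: t_def field_simps)
      have "(A + B) * (t * (\<bar>f x\<bar> / A) + (1 - t) * (\<bar>g x\<bar> / B))
          = ((A + B) * t) * (\<bar>f x\<bar> / A) + ((A + B) * (1 - t)) * (\<bar>g x\<bar> / B)"
        by (simp only: ring_distribs mult.assoc)
      also have "\<dots> = \<bar>f x\<bar> + \<bar>g x\<bar>" using pos by (simp only: t') simp
      finally have *: "(A + B) * (t * (\<bar>f x\<bar> / A) + (1 - t) * (\<bar>g x\<bar> / B)) = \<bar>f x\<bar> + \<bar>g x\<bar>" .
      have "\<bar>f x + g x\<bar> powr p \<le> (\<bar>f x\<bar> + \<bar>g x\<bar>) powr p"
        using p by (intro powr_mono2) auto
      also have "\<dots> = (A + B) powr p * (t * (\<bar>f x\<bar> / A) + (1 - t) * (\<bar>g x\<bar> / B)) powr p"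
        unfolding *[symmetric] using pos t by (subst powr_mult) auto
      also have "\<dots> \<le> (A + B) powr p *
          (t * (\<bar>f x\<bar> / A) powr p + (1 - t) * (\<bar>g x\<bar> / B) powr p)"
        using pos t p by (intro mult_left_mono convex_powr_le) auto
      finally show ?thesis using pos by (simp add: powr_divide)
    qed
    have "(\<integral>x. \<bar>f x + g x\<bar> powr p \<partial>M) \<le> (\<integral>x. (A + B) powr p *
        (t * (\<bar>f x\<bar> powr p / A powr p) + (1 - t) * (\<bar>g x\<bar> powr p / B powr p)) \<partial>M)"
      using integrable_add_powr[OF _ m i] p i le by (intro integral_mono) auto
    also have "\<dots> = (A + B) powr p * (t * (A powr p / A powr p) + (1 - t) * (B powr p / B powr p))"
      using i by (simp add: Ap)
    also have "\<dots> = (A + B) powr p" using pos by simp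
    finally have "?L \<le> ((A + B) powr p) powr (1 / p)"
      using p by (intro powr_mono2) auto
    also have "\<dots> = A + B" using pos p by (simp add: powr_powr)
    finally show ?thesis by (simp add: A_def B_def)
  qed
qed

lemma Lp_dist_class:
  assumes "p > 0" "f \<in> borel_measurable M" "g \<in> borel_measurable M"
    "integrable M (\<lambda>x. \<bar>f x\<bar> powr p)" "integrable M (\<lambda>x. \<bar>g x\<bar> powr p)"
  shows "Lp_dist M p (ae_class M f) (ae_class M g) = (\<integral>x. \<bar>f x - g x\<bar> powr p \<partial>M) powr (1 / p)"
  using assms by (simp add: Lp_dist_def Lp_minus_class Lp_norm_class Lp_carrierI)

lemma integrable_diff_powr:
  fixes f g :: "'a \<Rightarrow> real"
  assumes "p > 0" "f \<in> borel_measurable M" "g \<in> borel_measurable M"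
    "integrable M (\<lambda>x. \<bar>f x\<bar> powr p)" "integrable M (\<lambda>x. \<bar>g x\<bar> powr p)"
  shows "integrable M (\<lambda>x. \<bar>f x - g x\<bar> powr p)"
  using integrable_add_powr[of p f M "\<lambda>x. - g x"] assms by simp

lemma Metric_space_Lp:
  assumes p: "p \<ge> 1"
  shows "Metric_space (carrier (Lp M p)) (Lp_dist M p)"
proof
  have p0: "p > 0" using p by simp
  let ?d = "Lp_dist M p"
  show "0 \<le> ?d u v" for u v by (simp add: Lp_dist_def Lp_norm_def)
  show "?d u v = ?d v u" for u v
  proof (cases "u \<in> carrier (Lp M p) \<and> v \<in> carrier (Lp M p)")
    case True
    thus ?thesis using p0 by (auto elim!: Lp_carrierE simp: Lp_dist_class abs_minus_commute)
  qed (auto simp: Lp_dist_def)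
  fix u v assume "u \<in> carrier (Lp M p)" "v \<in> carrier (Lp M p)"
  note uv = this
  from uv obtain f g where f: "u = ae_class M f" "f \<in> borel_measurable M"
      "integrable M (\<lambda>x. \<bar>f x\<bar> powr p)"
    and g: "v = ae_class M g" "g \<in> borel_measurable M" "integrable M (\<lambda>x. \<bar>g x\<bar> powr p)"
    by (elim Lp_carrierE)
  have "Lp_dist M p u v = 0 \<longleftrightarrow> (AE x in M. f x = g x)"
    using integral_nonneg_eq_0_iff_AE[OF integrable_diff_powr[OF p0 f(2) g(2) f(3) g(3)]]
    by (simp add: f g p0 Lp_dist_class)
  also have "\<dots> \<longleftrightarrow> u = v"
  proof
    assume "u = v"
    hence "f \<in> ae_class M g" using f g by (auto simp: ae_class_def)
    thus "AE x in M. f x = g x" by (auto simp: ae_class_def eq_commute)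
  qed (simp add: f g ae_class_eq)
  finally show "?d u v = 0 \<longleftrightarrow> u = v" using uv by simp
  fix w assume w: "w \<in> carrier (Lp M p)"
  then obtain h where h: "w = ae_class M h" "h \<in> borel_measurable M"
      "integrable M (\<lambda>x. \<bar>h x\<bar> powr p)"
    by (elim Lp_carrierE)
  show "?d u w \<le> ?d u v + ?d v w"
    using Minkowski[of p "\<lambda>x. f x - g x" M "\<lambda>x. g x - h x"] uv w p p0 f g h
    by (simp add: Lp_dist_class integrable_diff_powr)
qed

end

theory Submission
  imports Defs
begin

text \<open>
  By a Baire-type argument, on \<open>S\<close> the essential supremum is at most a constant times the
  \<open>L\<^sub>p\<close>-norm. Since \<open>\<parallel>f\<parallel>\<^sub>p\<^sup>p \<le> (ess sup \<bar>f\<bar>)\<^sup>p\<^sup>-\<^sup>2 \<parallel>f\<parallel>\<^sub>2\<^sup>2\<close> for \<open>p > 2\<close>, and \<open>\<parallel>f\<parallel>\<^sub>p\<close> is bounded by a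
  multiple of \<open>\<parallel>f\<parallel>\<^sub>2\<close> for \<open>p \<le> 2\<close>, it is also at most \<open>\<surd>C\<close> times the \<open>L\<^sub>2\<close>-norm. If
  \<open>f\<^sub>1, \<dots>, f\<^sub>n\<close> are orthonormal in \<open>S\<close>, then almost surely
  \<open>(\<Sum> c\<^sub>i f\<^sub>i)\<^sup>2 \<le> C \<Sum> c\<^sub>i\<^sup>2\<close> simultaneously for all rational, hence for all real \<open>c\<close>. The choice
  \<open>c\<^sub>i = f\<^sub>i(\<omega>)\<close> gives \<open>\<Sum> f\<^sub>i\<^sup>2 \<le> C\<close>, and integration gives \<open>n \<le> C\<close>. So a maximal
  orthonormal family in \<open>S\<close> is finite, and it spans \<open>S\<close>.
\<close>

section \<open>Integral estimates and completeness over a probability space\<close>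

text \<open>With t = |f| / a one has t^q <= 1 + t^p; integrating over total mass 1 gives Jensen's
  inequality up to the factor 2. The scale \<open>a\<close> makes the bound homogeneous.\<close>

lemma (in prob_space) integral_abs_powr_mono_exponent:
  fixes f :: "'a \<Rightarrow> real"
  assumes q: "0 < q" "q \<le> p" and a: "a > 0"
    and f: "f \<in> borel_measurable M" "integrable M (\<lambda>x. \<bar>f x\<bar> powr p)"
    and le: "(\<integral>x. \<bar>f x\<bar> powr p \<partial>M) \<le> a powr p"
  shows "integrable M (\<lambda>x. \<bar>f x\<bar> powr q)" "(\<integral>x. \<bar>f x\<bar> powr q \<partial>M) \<le> 2 * a powr q"
proof -
  have pt: "\<bar>f x\<bar> powr q \<le> a powr q * (1 + \<bar>f x\<bar> powr p / a powr p)" for x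
  proof -
    let ?t = "\<bar>f x\<bar> / a"
    have "?t powr q \<le> 1 + ?t powr p"
    proof (cases "?t \<le> 1")
      case True
      hence "?t powr q \<le> 1" using q a by (intro powr_le1) auto
      thus ?thesis by (simp add: add_increasing2)
    next
      case False
      hence "?t powr q \<le> ?t powr p" using q by (intro powr_mono) auto
      thus ?thesis by simp
    qed
    thus ?thesis using a by (simp add: powr_divide field_simps)
  qed
  have int: "integrable M (\<lambda>x. a powr q * (1 + \<bar>f x\<bar> powr p / a powr p))"
    using f by (intro integrable_mult_right Bochner_Integration.integrable_add) auto
  show i: "integrable M (\<lambda>x. \<bar>f x\<bar> powr q)"
    by (rule Bochner_Integration.integrable_bound[OF int]) (use f pt in \<open>auto simp: abs_mult\<close>)
  have "(\<integral>x. \<bar>f x\<bar> powr q \<partial>M) \<le> (\<integral>x. a powr q * (1 + \<bar>f x\<bar> powr p / a powr p) \<partial>M)"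
    by (rule integral_mono[OF i int pt])
  also have "\<dots> = a powr q * (1 + (\<integral>x. \<bar>f x\<bar> powr p \<partial>M) / a powr p)"
    using f by (simp add: prob_space)
  also have "\<dots> \<le> a powr q * 2"
    using le a by (intro mult_left_mono) (auto simp: field_simps)
  finally show "(\<integral>x. \<bar>f x\<bar> powr q \<partial>M) \<le> 2 * a powr q" by simp
qed

text \<open>Completeness of L_p with a rate. Summability of \<open>r\<close> makes the increments
  summable in L_1, so the sequence itself converges almost surely, without passing to a subsequence;
  Fatou's lemma hands the Cauchy bounds on to the limit.\<close>

lemma (in prob_space) rapidly_Cauchy_Lp_limit:
  fixes x :: "nat \<Rightarrow> 'a \<Rightarrow> real"
  assumes p: "p \<ge> 1" and meas [measurable]: "\<And>k. x k \<in> borel_measurable M"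
    and int: "\<And>k. integrable M (\<lambda>\<omega>. \<bar>x k \<omega>\<bar> powr p)"
    and r: "\<And>k. r k > 0" "summable r"
    and Cauchy: "\<And>k n. k \<le> n \<Longrightarrow> (\<integral>\<omega>. \<bar>x n \<omega> - x k \<omega>\<bar> powr p \<partial>M) \<le> r k powr p"
  obtains y where "y \<in> borel_measurable M" "integrable M (\<lambda>\<omega>. \<bar>y \<omega>\<bar> powr p)"
    "\<And>k. (\<integral>\<omega>. \<bar>y \<omega> - x k \<omega>\<bar> powr p \<partial>M) \<le> r k powr p"
proof -
  have intd: "integrable M (\<lambda>\<omega>. \<bar>x n \<omega> - x k \<omega>\<bar> powr p)" for n k
    using p meas int by (intro integrable_diff_powr) auto
  define d where "d k \<omega> = x (Suc k) \<omega> - x k \<omega>" for k \<omega>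
  have d_meas [measurable]: "d k \<in> borel_measurable M" for k
    unfolding d_def by measurable
  \<comment> \<open>Exponent 1 with scale \<open>r k\<close> turns the L_p bound on an increment
    into an L_1 bound.\<close>
  have d_int: "integrable M (\<lambda>\<omega>. \<bar>d k \<omega>\<bar>)" "(\<integral>\<omega>. \<bar>d k \<omega>\<bar> \<partial>M) \<le> 2 * r k" for k
    using integral_abs_powr_mono_exponent[of 1 p "r k" "d k"] p r(1)[of k] intd[of "Suc k" k]
      Cauchy[of k "Suc k"] by (simp_all add: d_def)
  have "(\<integral>\<^sup>+\<omega>. (\<Sum>k. ennreal \<bar>d k \<omega>\<bar>) \<partial>M) = (\<Sum>k. \<integral>\<^sup>+\<omega>. ennreal \<bar>d k \<omega>\<bar> \<partial>M)"
    by (rule nn_integral_suminf) measurable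
  also have "\<dots> \<le> (\<Sum>k. ennreal (2 * r k))"
    using d_int by (intro suminf_le) (auto simp: nn_integral_eq_integral ennreal_leI)
  also have "\<dots> < \<infinity>"
    using r by (subst suminf_ennreal2) (auto intro: less_imp_le summable_mult)
  finally have "AE \<omega> in M. (\<Sum>k. ennreal \<bar>d k \<omega>\<bar>) \<noteq> \<infinity>"
    by (intro nn_integral_PInf_AE) auto
  hence conv: "AE \<omega> in M. convergent (\<lambda>n. x n \<omega>)"
  proof eventually_elim
    case (elim \<omega>)
    have "summable (\<lambda>k. \<bar>d k \<omega>\<bar>)"
      using elim by (intro summable_suminf_not_top) auto
    hence "summable (\<lambda>k. d k \<omega>)" by (rule summable_rabs_cancel)
    hence "convergent (\<lambda>n. \<Sum>k<n. d k \<omega>)" by (simp add: summable_iff_convergent)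
    moreover have "(\<Sum>k<n. d k \<omega>) = x n \<omega> - x 0 \<omega>" for n
      unfolding d_def by (rule sum_lessThan_telescope)
    ultimately have "convergent (\<lambda>n. x n \<omega> - x 0 \<omega>)" by simp
    thus ?case using convergent_add[OF _ convergent_const[of "x 0 \<omega>"]] by fastforce
  qed
  \<comment> \<open>Off the convergence set, which has full measure, the value of \<open>lim\<close>
    is unspecified.\<close>
  define y where "y \<omega> = lim (\<lambda>n. x n \<omega>)" for \<omega>
  have y_meas [measurable]: "y \<in> borel_measurable M"
    unfolding y_def by measurable
  \<comment> \<open>Stated with the nonnegative integral because integrability of the difference is
    only deduced from this bound.\<close>
  have fatou: "(\<integral>\<^sup>+\<omega>. ennreal (\<bar>y \<omega> - x k \<omega>\<bar> powr p) \<partial>M) \<le> ennreal (r k powr p)" for k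
  proof -
    have "(\<integral>\<^sup>+\<omega>. ennreal (\<bar>y \<omega> - x k \<omega>\<bar> powr p) \<partial>M) =
        (\<integral>\<^sup>+\<omega>. liminf (\<lambda>n. ennreal (\<bar>x n \<omega> - x k \<omega>\<bar> powr p)) \<partial>M)"
    proof (rule nn_integral_cong_AE, use conv in eventually_elim)
      case (elim \<omega>)
      hence "(\<lambda>n. x n \<omega>) \<longlonglongrightarrow> y \<omega>" by (simp add: y_def convergent_LIMSEQ_iff)
      hence "(\<lambda>n. ennreal (\<bar>x n \<omega> - x k \<omega>\<bar> powr p)) \<longlonglongrightarrow> ennreal (\<bar>y \<omega> - x k \<omega>\<bar> powr p)"
        using p by (intro tendsto_ennrealI tendsto_powr2 tendsto_intros) auto
      thus ?case by (rule lim_imp_Liminf[OF trivial_limit_sequentially, symmetric])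
    qed
    also have "\<dots> \<le> liminf (\<lambda>n. \<integral>\<^sup>+\<omega>. ennreal (\<bar>x n \<omega> - x k \<omega>\<bar> powr p) \<partial>M)"
      by (rule nn_integral_liminf) measurable
    also have "\<dots> \<le> liminf (\<lambda>n. ennreal (r k powr p))"
      using Cauchy intd
      by (intro Liminf_mono eventually_sequentiallyI[of k]) (auto simp: nn_integral_eq_integral ennreal_leI)
    finally show ?thesis by (simp add: Liminf_const)
  qed
  have yk: "integrable M (\<lambda>\<omega>. \<bar>y \<omega> - x k \<omega>\<bar> powr p)" for k
    using fatou[of k] by (intro integrableI_nonneg) (auto intro: le_less_trans)
  show ?thesis
  proof (rule that[OF y_meas])
    show "integrable M (\<lambda>\<omega>. \<bar>y \<omega>\<bar> powr p)"
      using integrable_add_powr[of p "\<lambda>\<omega>. y \<omega> - x 0 \<omega>" M "x 0"] p yk[of 0] int[of 0] by simp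
    show "(\<integral>\<omega>. \<bar>y \<omega> - x k \<omega>\<bar> powr p \<partial>M) \<le> r k powr p" for k
      using fatou[of k] yk[of k] by (simp add: nn_integral_eq_integral)
  qed
qed

lemma (in prob_space) integrable_powr_of_ess_bounded:
  fixes f :: "'a \<Rightarrow> real"
  assumes "f \<in> borel_measurable M" "AE x in M. \<bar>f x\<bar> \<le> C" "q \<ge> 0"
  shows "integrable M (\<lambda>x. \<bar>f x\<bar> powr q)"
proof (rule integrable_const_bound[where B = "C powr q"])
  show "AE x in M. norm (\<bar>f x\<bar> powr q) \<le> C powr q"
    using assms(2) by eventually_elim (use assms(3) in \<open>auto intro: powr_mono2\<close>)
qed (use assms in measurable)

lemma (in prob_space) integrable_mult_of_ess_bounded:
  fixes f g :: "'a \<Rightarrow> real"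
  assumes "f \<in> borel_measurable M" "AE x in M. \<bar>f x\<bar> \<le> C"
    and "g \<in> borel_measurable M" "AE x in M. \<bar>g x\<bar> \<le> D"
  shows "integrable M (\<lambda>x. f x * g x)"
proof (rule integrable_const_bound[where B = "C * D"])
  show "AE x in M. norm (f x * g x) \<le> C * D"
    using assms(2,4) by eventually_elim (auto simp: abs_mult intro!: mult_mono)
qed (use assms in measurable)

section \<open>The subspace as a set of functions\<close>

text \<open>Functions replace almost-everywhere classes, so that the vector operations are
  pointwise; the intended \<open>V\<close> consists of all measurable representatives of classes in
  \<open>S\<close>. \<open>closed\<close> is sequential closedness in L_p; with constant
  \<open>X\<close> it also gives invariance under measurable changes on null sets.\<close>

locale ess_bounded_Lp_subspace = prob_space M for M :: "'a measure" +
  fixes p :: real and V :: "('a \<Rightarrow> real) set"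
  assumes p_gt_1: "p > 1"
    and measurable_V [measurable_dest]: "f \<in> V \<Longrightarrow> f \<in> borel_measurable M"
    and ess_bounded: "f \<in> V \<Longrightarrow> \<exists>C. AE x in M. \<bar>f x\<bar> \<le> C"
    and zero_in: "(\<lambda>x. 0) \<in> V"
    and add_in: "f \<in> V \<Longrightarrow> g \<in> V \<Longrightarrow> (\<lambda>x. f x + g x) \<in> V"
    and scale_in: "f \<in> V \<Longrightarrow> (\<lambda>x. c * f x) \<in> V"
    and closed: "\<lbrakk>\<And>k. X k \<in> V; f \<in> borel_measurable M; integrable M (\<lambda>x. \<bar>f x\<bar> powr p);
      (\<lambda>k. \<integral>x. \<bar>X k x - f x\<bar> powr p \<partial>M) \<longlonglongrightarrow> 0\<rbrakk> \<Longrightarrow> f \<in> V"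
begin

definition nrm :: "('a \<Rightarrow> real) \<Rightarrow> real" where
  "nrm f = (\<integral>x. \<bar>f x\<bar> powr p \<partial>M) powr (1 / p)"

lemma diff_in: "f \<in> V \<Longrightarrow> g \<in> V \<Longrightarrow> (\<lambda>x. f x - g x) \<in> V"
  using add_in[of f "\<lambda>x. - 1 * g x"] scale_in[of g "-1"] by simp

lemma sum_in: "(\<And>i. i < n \<Longrightarrow> f i \<in> V) \<Longrightarrow> (\<lambda>x. \<Sum>i<n. c i * f i x) \<in> V" for n :: nat
proof (induction n)
  case (Suc n)
  thus ?case using add_in[OF Suc.IH scale_in[of "f n" "c n"]] by simp
qed (simp add: zero_in)

lemma integrable_powr: "f \<in> V \<Longrightarrow> q \<ge> 0 \<Longrightarrow> integrable M (\<lambda>x. \<bar>f x\<bar> powr q)"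
  using ess_bounded measurable_V integrable_powr_of_ess_bounded by blast

lemma integrable_mult: "f \<in> V \<Longrightarrow> g \<in> V \<Longrightarrow> integrable M (\<lambda>x. f x * g x)"
  using ess_bounded[of f] ess_bounded[of g] measurable_V integrable_mult_of_ess_bounded by blast

lemma nrm_nonneg: "nrm f \<ge> 0"
  by (simp add: nrm_def)

lemma nrm_powr: "nrm f powr p = (\<integral>x. \<bar>f x\<bar> powr p \<partial>M)"
  using p_gt_1 by (simp add: nrm_def powr_powr)

lemma nrm_le_iff: "r \<ge> 0 \<Longrightarrow> nrm f \<le> r \<longleftrightarrow> (\<integral>x. \<bar>f x\<bar> powr p \<partial>M) \<le> r powr p"
  using p_gt_1 nrm_nonneg[of f] powr_mono2[of p "nrm f" r] powr_less_mono2[of p r "nrm f"]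
  by (auto simp flip: nrm_powr simp: not_le[symmetric])

lemma nrm_scale: "nrm (\<lambda>x. c * f x) = \<bar>c\<bar> * nrm f"
  using p_gt_1 by (simp add: nrm_def abs_mult powr_mult powr_powr)

lemma nrm_triangle: "f \<in> V \<Longrightarrow> g \<in> V \<Longrightarrow> nrm (\<lambda>x. f x + g x) \<le> nrm f + nrm g"
  unfolding nrm_def using p_gt_1 integrable_powr[of _ p] by (intro Minkowski) auto

lemma nrm_eq_0: "f \<in> V \<Longrightarrow> nrm f = 0 \<Longrightarrow> AE x in M. f x = 0"
  using integral_nonneg_eq_0_iff_AE[OF integrable_powr[of f p]] p_gt_1 by (simp add: nrm_def)

section \<open>Control of the essential supremum by the L_p-norm\<close>

text \<open>If \<open>\<bar>x + g\<bar>\<close> and \<open>\<bar>x - g\<bar>\<close> are both essentially at most \<open>k + 1\<close>, then so is \<open>\<bar>g\<bar>\<close>.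
  So a small step in one of the directions \<open>\<plusminus>g\<close> escapes any given bound, robustly under
  small perturbations in \<open>L\<^sub>p\<close> by Chebyshev's inequality.\<close>

lemma escape_bound:
  assumes unbounded: "\<And>K. \<exists>f\<in>V. \<not> (AE \<omega> in M. \<bar>f \<omega>\<bar> \<le> K * nrm f)"
    and x: "x \<in> V" and r: "r > 0" and k: "k \<ge> 0"
  obtains x' r' where "x' \<in> V" "0 < r'" "r' \<le> r / 2" "nrm (\<lambda>\<omega>. x' \<omega> - x \<omega>) \<le> r / 2"
    "\<And>y. \<lbrakk>y \<in> borel_measurable M; integrable M (\<lambda>\<omega>. \<bar>y \<omega>\<bar> powr p);
      (\<integral>\<omega>. \<bar>y \<omega> - x' \<omega>\<bar> powr p \<partial>M) \<le> r' powr p\<rbrakk> \<Longrightarrow> \<not> (AE \<omega> in M. \<bar>y \<omega>\<bar> \<le> k)"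
proof -
  \<comment> \<open>The factor 2 (k + 1) / r becomes the bound k + 1 once \<open>f\<close> is
    rescaled to norm r / 2.\<close>
  from unbounded obtain f where f: "f \<in> V" "\<not> (AE \<omega> in M. \<bar>f \<omega>\<bar> \<le> (2 * (k + 1) / r) * nrm f)"
    by blast
  have "nrm f \<noteq> 0"
  proof
    assume "nrm f = 0"
    moreover from this have "AE \<omega> in M. f \<omega> = 0" using f nrm_eq_0 by blast
    ultimately show False using f(2) by simp
  qed
  hence nf: "nrm f > 0" using nrm_nonneg[of f] by simp
  define c where "c = r / (2 * nrm f)"
  define g where "g \<omega> = c * f \<omega>" for \<omega>
  have c: "c > 0" using nf r by (simp add: c_def)
  have g: "g \<in> V" unfolding g_def using f scale_in by blast
  have ng: "nrm g = r / 2" unfolding g_def nrm_scale using nf r by (simp add: c_def)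
  have ung: "\<not> (AE \<omega> in M. \<bar>g \<omega>\<bar> \<le> k + 1)"
  proof
    assume "AE \<omega> in M. \<bar>g \<omega>\<bar> \<le> k + 1"
    hence "AE \<omega> in M. \<bar>f \<omega>\<bar> \<le> (2 * (k + 1) / r) * nrm f"
      by eventually_elim (use c nf r in \<open>simp add: g_def c_def abs_mult field_simps\<close>)
    thus False using f by simp
  qed
  have "\<exists>x'\<in>V. nrm (\<lambda>\<omega>. x' \<omega> - x \<omega>) \<le> r / 2 \<and> \<not> (AE \<omega> in M. \<bar>x' \<omega>\<bar> \<le> k + 1)"
  proof (cases "AE \<omega> in M. \<bar>x \<omega> + g \<omega>\<bar> \<le> k + 1")
    case False
    thus ?thesis using x g ng by (intro bexI[of _ "\<lambda>\<omega>. x \<omega> + g \<omega>"]) (auto intro: add_in)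
  next
    case True
    have "\<not> (AE \<omega> in M. \<bar>x \<omega> - g \<omega>\<bar> \<le> k + 1)"
    proof
      assume "AE \<omega> in M. \<bar>x \<omega> - g \<omega>\<bar> \<le> k + 1"
      with True have "AE \<omega> in M. \<bar>g \<omega>\<bar> \<le> k + 1" by eventually_elim arith
      thus False using ung by simp
    qed
    moreover have "nrm (\<lambda>\<omega>. x \<omega> - g \<omega> - x \<omega>) \<le> r / 2"
      using nrm_scale[of "-1" g] ng by simp
    ultimately show ?thesis using x g by (intro bexI[of _ "\<lambda>\<omega>. x \<omega> - g \<omega>"]) (auto intro: diff_in)
  qed
  then obtain x' where x': "x' \<in> V" "nrm (\<lambda>\<omega>. x' \<omega> - x \<omega>) \<le> r / 2"
    "\<not> (AE \<omega> in M. \<bar>x' \<omega>\<bar> \<le> k + 1)" by blast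
  have [measurable]: "x' \<in> borel_measurable M" using x'(1) measurable_V by blast
  \<comment> \<open>On \<open>A\<close> the modulus of \<open>x'\<close> exceeds k + 1, so |y| <= k
    there forces |y - x'| >= 1. This margin is what Chebyshev's inequality uses.\<close>
  define A where "A = {\<omega> \<in> space M. \<not> \<bar>x' \<omega>\<bar> \<le> k + 1}"
  have A [measurable]: "A \<in> sets M" unfolding A_def by measurable
  have "prob A \<noteq> 0"
    using x'(3) AE_iff_measurable[OF A, of "\<lambda>\<omega>. \<bar>x' \<omega>\<bar> \<le> k + 1"]
    by (auto simp: A_def emeasure_eq_measure)
  hence pA: "prob A > 0" by (simp add: zero_less_measure_iff)
  \<comment> \<open>Small enough that the p-th power of \<open>r'\<close> is at most half of
    \<open>prob A\<close>, while a bound \<open>k\<close> on \<open>y\<close> would force the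
    integral of |y - x'|^p up to \<open>prob A\<close>.\<close>
  define r' where "r' = min (r / 2) ((prob A / 2) powr (1 / p))"
  have r': "r' > 0" "r' \<le> r / 2" using r pA by (auto simp: r'_def)
  have "r' powr p \<le> ((prob A / 2) powr (1 / p)) powr p"
    using r' p_gt_1 by (intro powr_mono2) (auto simp: r'_def)
  also have "\<dots> < prob A" using pA p_gt_1 by (simp add: powr_powr)
  finally have r'A: "r' powr p < prob A" .
  show ?thesis
  proof (rule that[OF x'(1) r' x'(2)])
    fix y assume [measurable]: "y \<in> borel_measurable M" and y: "integrable M (\<lambda>\<omega>. \<bar>y \<omega>\<bar> powr p)"
      and le: "(\<integral>\<omega>. \<bar>y \<omega> - x' \<omega>\<bar> powr p \<partial>M) \<le> r' powr p"
    show "\<not> (AE \<omega> in M. \<bar>y \<omega>\<bar> \<le> k)"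
    proof
      assume bd: "AE \<omega> in M. \<bar>y \<omega>\<bar> \<le> k"
      have "prob A = (\<integral>\<omega>. indicator A \<omega> \<partial>M)" using A by simp
      also have "\<dots> \<le> (\<integral>\<omega>. \<bar>y \<omega> - x' \<omega>\<bar> powr p \<partial>M)"
      proof (rule integral_mono_AE)
        show "integrable M (\<lambda>\<omega>. indicator A \<omega> :: real)"
          by (rule integrable_real_indicator) (auto simp: less_top[symmetric])
        show "integrable M (\<lambda>\<omega>. \<bar>y \<omega> - x' \<omega>\<bar> powr p)"
          using p_gt_1 y integrable_powr[OF x'(1), of p] by (intro integrable_diff_powr) auto
        show "AE \<omega> in M. indicator A \<omega> \<le> \<bar>y \<omega> - x' \<omega>\<bar> powr p"
          using bd
        proof eventually_elim
          case (elim \<omega>)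
          show ?case
          proof (cases "\<omega> \<in> A")
            case True
            hence "\<bar>y \<omega> - x' \<omega>\<bar> \<ge> 1" using elim by (auto simp: A_def)
            thus ?thesis using True p_gt_1 by (simp add: ge_one_powr_ge_zero)
          qed simp
        qed
      qed
      finally show False using le r'A by simp
    qed
  qed
qed

text \<open>If no constant worked, \<open>escape_bound\<close> could be iterated with the bounds 0,
  1, 2, ..., giving nested shrinking balls. Their common point lies in \<open>V\<close> by
  closedness, yet escapes every bound, against essential boundedness.\<close>

lemma ess_sup_le_nrm: "\<exists>K. \<forall>f\<in>V. AE \<omega> in M. \<bar>f \<omega>\<bar> \<le> K * nrm f"
proof (rule ccontr)
  assume "\<not> ?thesis"
  hence unbounded: "\<And>K. \<exists>f\<in>V. \<not> (AE \<omega> in M. \<bar>f \<omega>\<bar> \<le> K * nrm f)" by blast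
  \<comment> \<open>A state is a pair of centre and radius. \<open>P\<close> is the invariant at
    stage \<open>n\<close>; \<open>Q\<close> describes the passage to the next ball, all of whose
    points escape the bound \<open>n\<close>.\<close>
  define P where "P n s \<longleftrightarrow> fst s \<in> V \<and> 0 < snd s \<and> snd s \<le> (1/2) ^ n"
    for n :: nat and s :: "('a \<Rightarrow> real) \<times> real"
  define Q where "Q n s t \<longleftrightarrow> snd t \<le> snd s / 2 \<and> nrm (\<lambda>\<omega>. fst t \<omega> - fst s \<omega>) \<le> snd s / 2 \<and>
      (\<forall>y\<in>borel_measurable M. integrable M (\<lambda>\<omega>. \<bar>y \<omega>\<bar> powr p) \<longrightarrow>
        (\<integral>\<omega>. \<bar>y \<omega> - fst t \<omega>\<bar> powr p \<partial>M) \<le> snd t powr p \<longrightarrow> \<not> (AE \<omega> in M. \<bar>y \<omega>\<bar> \<le> real n))"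
    for n :: nat and s t :: "('a \<Rightarrow> real) \<times> real"
  have "\<exists>s. \<forall>n. P n (s n) \<and> Q n (s n) (s (Suc n))"
  proof (rule dependent_nat_choice)
    show "\<exists>s. P 0 s" using zero_in by (intro exI[of _ "(\<lambda>_. 0, 1)"]) (auto simp: P_def)
    fix s n assume s: "P n s"
    then obtain x' r' where "x' \<in> V" "0 < r'" "r' \<le> snd s / 2" "nrm (\<lambda>\<omega>. x' \<omega> - fst s \<omega>) \<le> snd s / 2"
      "\<And>y. \<lbrakk>y \<in> borel_measurable M; integrable M (\<lambda>\<omega>. \<bar>y \<omega>\<bar> powr p);
      (\<integral>\<omega>. \<bar>y \<omega> - x' \<omega>\<bar> powr p \<partial>M) \<le> r' powr p\<rbrakk> \<Longrightarrow> \<not> (AE \<omega> in M. \<bar>y \<omega>\<bar> \<le> real n)"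
      using escape_bound[OF unbounded, of "fst s" "snd s" "real n"] by (auto simp: P_def)
    thus "\<exists>t. P (Suc n) t \<and> Q n s t"
      using s by (intro exI[of _ "(x', r')"]) (auto simp: P_def Q_def)
  qed
  then obtain s where s: "P n (s n)" "Q n (s n) (s (Suc n))" for n by blast
  define x r where "x n = fst (s n)" and "r n = snd (s n)" for n
  have xV: "x n \<in> V" and r0: "r n > 0" and rn: "r n \<le> (1/2) ^ n"
    and step: "r (Suc n) \<le> r n / 2" "nrm (\<lambda>\<omega>. x (Suc n) \<omega> - x n \<omega>) \<le> r n / 2"
    and esc: "y \<in> borel_measurable M \<Longrightarrow> integrable M (\<lambda>\<omega>. \<bar>y \<omega>\<bar> powr p) \<Longrightarrow>
      (\<integral>\<omega>. \<bar>y \<omega> - x (Suc n) \<omega>\<bar> powr p \<partial>M) \<le> r (Suc n) powr p \<Longrightarrow> \<not> (AE \<omega> in M. \<bar>y \<omega>\<bar> \<le> real n)"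
    for n y
    using s[of n] by (auto simp: P_def Q_def x_def r_def)
  \<comment> \<open>Subtracting \<open>r n\<close> closes the induction: r n / 2 + (r k - r n) <= r
    k - r (Suc n), since the radii at least halve.\<close>
  have tele: "nrm (\<lambda>\<omega>. x n \<omega> - x k \<omega>) \<le> r k - r n" if "k \<le> n" for k n
    using that
  proof (induction n rule: dec_induct)
    case base
    show ?case by (simp add: nrm_def)
  next
    case (step n)
    have "nrm (\<lambda>\<omega>. x (Suc n) \<omega> - x k \<omega>) = nrm (\<lambda>\<omega>. (x (Suc n) \<omega> - x n \<omega>) + (x n \<omega> - x k \<omega>))"
      by simp
    also have "\<dots> \<le> nrm (\<lambda>\<omega>. x (Suc n) \<omega> - x n \<omega>) + nrm (\<lambda>\<omega>. x n \<omega> - x k \<omega>)"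
      by (intro nrm_triangle diff_in xV)
    finally show ?case
      using step.IH \<open>r (Suc n) \<le> r n / 2\<close> \<open>nrm (\<lambda>\<omega>. x (Suc n) \<omega> - x n \<omega>) \<le> r n / 2\<close> by linarith
  qed
  have half: "summable (\<lambda>n. (1/2) ^ n :: real)" by (simp add: summable_geometric)
  obtain y where y: "y \<in> borel_measurable M" "integrable M (\<lambda>\<omega>. \<bar>y \<omega>\<bar> powr p)"
    and yx: "\<And>k. (\<integral>\<omega>. \<bar>y \<omega> - x k \<omega>\<bar> powr p \<partial>M) \<le> r k powr p"
  proof (rule rapidly_Cauchy_Lp_limit[of p x r])
    show "summable r"
      by (rule summable_comparison_test'[OF half, of 0]) (use r0 rn in \<open>simp add: less_imp_le\<close>)
    show "(\<integral>\<omega>. \<bar>x n \<omega> - x k \<omega>\<bar> powr p \<partial>M) \<le> r k powr p" if "k \<le> n" for k n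
      using tele[OF that] r0[of n] r0[of k] by (subst nrm_le_iff[symmetric]) auto
  qed (use p_gt_1 xV r0 measurable_V integrable_powr in auto)
  have "y \<in> V"
  proof (rule closed[OF xV y], rule tendsto_sandwich[where f = "\<lambda>_. 0"])
    show "(\<lambda>k. ((1/2) ^ k) powr p) \<longlonglongrightarrow> 0"
      using p_gt_1 by (intro tendsto_zero_powrI[OF _ tendsto_const]) (auto intro!: LIMSEQ_power_zero)
    have "(\<integral>\<omega>. \<bar>x k \<omega> - y \<omega>\<bar> powr p \<partial>M) \<le> ((1/2) ^ k) powr p" for k
    proof -
      have "(\<integral>\<omega>. \<bar>x k \<omega> - y \<omega>\<bar> powr p \<partial>M) \<le> r k powr p"
        using yx[of k] by (simp add: abs_minus_commute)
      also have "\<dots> \<le> ((1/2) ^ k) powr p"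
        using r0[of k] rn[of k] p_gt_1 by (intro powr_mono2) auto
      finally show ?thesis .
    qed
    thus "\<forall>\<^sub>F k in sequentially. (\<integral>\<omega>. \<bar>x k \<omega> - y \<omega>\<bar> powr p \<partial>M) \<le> ((1/2) ^ k) powr p" by simp
  qed auto
  then obtain C where C: "AE \<omega> in M. \<bar>y \<omega>\<bar> \<le> C" using ess_bounded by blast
  \<comment> \<open>\<open>y\<close> also lies in the ball of index \<open>Suc k\<close>, none of
    whose points is essentially bounded by \<open>k\<close>.\<close>
  obtain k where k: "C \<le> real k" using real_arch_simple by blast
  from C have "AE \<omega> in M. \<bar>y \<omega>\<bar> \<le> real k" by eventually_elim (use k in simp)
  thus False using esc[OF y yx] by blast
qed

section \<open>Comparison with the L_2-norm\<close>

lemma ess_sup_le_L2: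
  obtains C where "C > 0" "\<And>f. f \<in> V \<Longrightarrow> AE \<omega> in M. (f \<omega>)\<^sup>2 \<le> C * (\<integral>\<omega>. (f \<omega>)\<^sup>2 \<partial>M)"
proof -
  obtain K0 where K0: "\<And>f. f \<in> V \<Longrightarrow> AE \<omega> in M. \<bar>f \<omega>\<bar> \<le> K0 * nrm f"
    using ess_sup_le_nrm by blast
  define K where "K = max K0 1"
  have K: "K > 0" by (simp add: K_def)
  have Kb: "AE \<omega> in M. \<bar>f \<omega>\<bar> \<le> K * nrm f" if "f \<in> V" for f
    using K0[OF that]
  proof eventually_elim
    case (elim \<omega>)
    also have "K0 * nrm f \<le> K * nrm f"
      using nrm_nonneg by (intro mult_right_mono) (auto simp: K_def)
    finally show ?case .
  qed
  \<comment> \<open>The first entry serves p <= 2, the second p > 2.\<close>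
  define B where "B = max (2 powr (2 / p)) (K powr (p - 2))"
  have B: "B > 0" by (simp add: B_def less_max_iff_disj)
  have nB: "(nrm f)\<^sup>2 \<le> B * (\<integral>\<omega>. (f \<omega>)\<^sup>2 \<partial>M)" if f: "f \<in> V" for f
  proof (cases "nrm f = 0")
    case True
    thus ?thesis using B by simp
  next
    case False
    hence nf: "nrm f > 0" using nrm_nonneg[of f] by simp
    let ?I = "\<integral>\<omega>. (f \<omega>)\<^sup>2 \<partial>M"
    have I_int: "integrable M (\<lambda>\<omega>. (f \<omega>)\<^sup>2)"
      using integrable_mult[OF f f] by (simp add: power2_eq_square)
    \<comment> \<open>Nonzero, so that its square root can be the positive scale in the case p <=
      2.\<close>
    have "?I \<noteq> 0"
    proof
      assume "?I = 0"
      hence "AE \<omega> in M. f \<omega> = 0" using integral_nonneg_eq_0_iff_AE[OF I_int] by simp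
      hence "(\<integral>\<omega>. \<bar>f \<omega>\<bar> powr p \<partial>M) = (\<integral>\<omega>. 0 \<partial>M)"
        using measurable_V[OF f] by (intro integral_cong_AE) auto
      thus False using False by (simp add: nrm_def)
    qed
    moreover have "?I \<ge> 0" by simp
    ultimately have I: "?I > 0" by linarith
    show ?thesis
    proof (cases "p \<le> 2")
      case True
      define a where "a = sqrt ?I"
      have a: "a > 0" "a\<^sup>2 = ?I" using I by (auto simp: a_def)
      \<comment> \<open>Here 2 is the larger exponent and \<open>p\<close> the smaller one.\<close>
      have "(\<integral>\<omega>. \<bar>f \<omega>\<bar> powr p \<partial>M) \<le> 2 * a powr p"
        using integral_abs_powr_mono_exponent(2)[of p 2 a f] True p_gt_1 a f I_int measurable_V
        by simp
      also have "\<dots> = (2 powr (1 / p) * a) powr p"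
        using a p_gt_1 by (simp add: powr_mult powr_powr)
      finally have "nrm f \<le> 2 powr (1 / p) * a"
        using a by (subst nrm_le_iff) auto
      hence "(nrm f)\<^sup>2 \<le> (2 powr (1 / p) * a)\<^sup>2" using nrm_nonneg by (intro power_mono) auto
      also have "\<dots> = 2 powr (2 / p) * ?I"
        by (simp add: power_mult_distrib a powr_power)
      also have "\<dots> \<le> B * ?I" using I by (intro mult_right_mono) (auto simp: B_def)
      finally show ?thesis .
    next
      case False
      \<comment> \<open>Both ends of the chain carry the positive factor
        \<open>nrm f powr (p - 2)\<close>; cancelling it leaves a bound on the square of the
        norm.\<close>
      have "nrm f powr (p - 2) * (nrm f)\<^sup>2 = nrm f powr p"
        using nf powr_add[of "nrm f" "p - 2" 2] by simp
      also have "\<dots> = (\<integral>\<omega>. \<bar>f \<omega>\<bar> powr p \<partial>M)" by (rule nrm_powr)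
      also have "\<dots> \<le> (\<integral>\<omega>. (K * nrm f) powr (p - 2) * (f \<omega>)\<^sup>2 \<partial>M)"
      proof (rule integral_mono_AE)
        show "AE \<omega> in M. \<bar>f \<omega>\<bar> powr p \<le> (K * nrm f) powr (p - 2) * (f \<omega>)\<^sup>2"
          using Kb[OF f]
        proof eventually_elim
          case (elim \<omega>)
          have "\<bar>f \<omega>\<bar> powr p = \<bar>f \<omega>\<bar> powr (p - 2) * (f \<omega>)\<^sup>2"
            using powr_add[of "\<bar>f \<omega>\<bar>" "p - 2" 2] by (cases "f \<omega> = 0") auto
          also have "\<dots> \<le> (K * nrm f) powr (p - 2) * (f \<omega>)\<^sup>2"
            using elim False by (intro mult_right_mono powr_mono2) auto
          finally show ?case .
        qed
      qed (use integrable_powr[OF f, of p] p_gt_1 I_int in auto)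
      also have "\<dots> = nrm f powr (p - 2) * (K powr (p - 2) * ?I)"
        using K nf by (simp add: powr_mult)
      finally have "(nrm f)\<^sup>2 \<le> K powr (p - 2) * ?I" using nf by simp
      also have "\<dots> \<le> B * ?I" using I by (intro mult_right_mono) (auto simp: B_def)
      finally show ?thesis .
    qed
  qed
  show ?thesis
  proof (rule that[of "K\<^sup>2 * B"])
    fix f assume f: "f \<in> V"
    show "AE \<omega> in M. (f \<omega>)\<^sup>2 \<le> K\<^sup>2 * B * (\<integral>\<omega>. (f \<omega>)\<^sup>2 \<partial>M)"
      using Kb[OF f]
    proof eventually_elim
      case (elim \<omega>)
      hence "(f \<omega>)\<^sup>2 \<le> (K * nrm f)\<^sup>2" by (metis abs_ge_zero power2_abs power_mono)
      also have "\<dots> = K\<^sup>2 * (nrm f)\<^sup>2" by (simp add: power_mult_distrib)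
      also have "\<dots> \<le> K\<^sup>2 * (B * (\<integral>\<omega>. (f \<omega>)\<^sup>2 \<partial>M))"
        using nB[OF f] by (intro mult_left_mono) auto
      finally show ?case by simp
    qed
  qed (use K B in simp)
qed

section \<open>Orthonormal families and their size\<close>

text \<open>The inner product is that of L_2 whatever \<open>p\<close> is; the products are
  integrable because members of \<open>V\<close> are essentially bounded.\<close>

definition orthonormal :: "nat \<Rightarrow> (nat \<Rightarrow> 'a \<Rightarrow> real) \<Rightarrow> bool" where
  "orthonormal n f \<longleftrightarrow> (\<forall>i<n. f i \<in> V) \<and>
    (\<forall>i<n. \<forall>j<n. (\<integral>\<omega>. f i \<omega> * f j \<omega> \<partial>M) = (if i = j then 1 else 0))"

lemma integral_sum_mult_orthonormal:
  assumes "orthonormal n f" "j < n"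
  shows "(\<integral>\<omega>. (\<Sum>i<n. c i * f i \<omega>) * f j \<omega> \<partial>M) = c j"
proof -
  have "(\<integral>\<omega>. (\<Sum>i<n. c i * f i \<omega>) * f j \<omega> \<partial>M) = (\<integral>\<omega>. (\<Sum>i<n. c i * (f i \<omega> * f j \<omega>)) \<partial>M)"
    by (simp add: sum_distrib_right mult.assoc)
  also have "\<dots> = (\<Sum>i<n. c i * (\<integral>\<omega>. f i \<omega> * f j \<omega> \<partial>M))"
    using assms by (subst Bochner_Integration.integral_sum) (auto simp: orthonormal_def intro: integrable_mult)
  also have "\<dots> = (\<Sum>i<n. if i = j then c i else 0)"
    using assms by (intro sum.cong) (auto simp: orthonormal_def)
  finally show ?thesis using assms(2) by simp
qed

text \<open>Parseval's identity: expand one of the two factors and integrate against each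
  \<open>f j\<close>.\<close>

lemma integral_sum_square_orthonormal:
  assumes "orthonormal n f"
  shows "(\<integral>\<omega>. (\<Sum>i<n. c i * f i \<omega>)\<^sup>2 \<partial>M) = (\<Sum>i<n. (c i)\<^sup>2)"
proof -
  have V: "f j \<in> V" if "j < n" for j using assms that by (simp add: orthonormal_def)
  have "(\<integral>\<omega>. (\<Sum>i<n. c i * f i \<omega>)\<^sup>2 \<partial>M) =
      (\<integral>\<omega>. (\<Sum>j<n. c j * ((\<Sum>i<n. c i * f i \<omega>) * f j \<omega>)) \<partial>M)"
    by (simp add: power2_eq_square sum_distrib_left mult_ac)
  also have "\<dots> = (\<Sum>j<n. c j * (\<integral>\<omega>. (\<Sum>i<n. c i * f i \<omega>) * f j \<omega> \<partial>M))"
    using V by (subst Bochner_Integration.integral_sum)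
      (auto intro!: integrable_mult_right integrable_mult sum_in)
  also have "\<dots> = (\<Sum>j<n. (c j)\<^sup>2)"
    using assms by (intro sum.cong) (auto simp: integral_sum_mult_orthonormal power2_eq_square)
  finally show ?thesis .
qed

text \<open>Choosing coefficients that depend on the point is legitimate only once a single null set
  serves all coefficient vectors; a countable dense set of vectors provides it.\<close>

lemma orthonormal_card_le:
  assumes C: "C > 0" "\<And>f. f \<in> V \<Longrightarrow> AE \<omega> in M. (f \<omega>)\<^sup>2 \<le> C * (\<integral>\<omega>. (f \<omega>)\<^sup>2 \<partial>M)"
    and f: "orthonormal n f"
  shows "real n \<le> C"
proof -
  have fV: "f i \<in> V" if "i < n" for i using f that by (simp add: orthonormal_def)
  \<comment> \<open>\<open>PiE\<close> fixes the values outside the index range, which keeps the set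
    of rational vectors countable.\<close>
  let ?Q = "PiE {..<n} (\<lambda>_. \<rat>) :: (nat \<Rightarrow> real) set"
  have "countable ?Q" by (intro countable_PiE) (auto simp: countable_rat)
  moreover have "AE \<omega> in M. (\<Sum>i<n. c i * f i \<omega>)\<^sup>2 \<le> C * (\<Sum>i<n. (c i)\<^sup>2)" for c
    using C(2)[OF sum_in[of n f c]] fV integral_sum_square_orthonormal[OF f, of c] by simp
  ultimately have "AE \<omega> in M. \<forall>c\<in>?Q. (\<Sum>i<n. c i * f i \<omega>)\<^sup>2 \<le> C * (\<Sum>i<n. (c i)\<^sup>2)"
    by (simp add: AE_ball_countable)
  hence bd: "AE \<omega> in M. (\<Sum>i<n. (f i \<omega>)\<^sup>2) \<le> C"
  proof eventually_elim
    case (elim \<omega>)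
    have "\<exists>q. (\<forall>m. q m \<in> \<rat>) \<and> q \<longlonglongrightarrow> t" for t :: real
      using closure_sequential[of t \<rat>] by (simp add: Rats_closure_real)
    hence "\<forall>i. \<exists>q. (\<forall>m. q m \<in> \<rat>) \<and> q \<longlonglongrightarrow> f i \<omega>" by blast
    then obtain q where q: "\<And>i m. q i m \<in> \<rat>" "\<And>i. q i \<longlonglongrightarrow> f i \<omega>"
      by (auto dest!: choice)
    let ?s = "\<Sum>i<n. (f i \<omega>)\<^sup>2"
    have "(\<Sum>i<n. q i m * f i \<omega>)\<^sup>2 \<le> C * (\<Sum>i<n. (q i m)\<^sup>2)" for m
      \<comment> \<open>\<open>restrict\<close> turns the approximant into a member of
        \<open>?Q\<close> without changing the sums.\<close>
      using bspec[OF elim, of "restrict (\<lambda>i. q i m) {..<n}"] q(1) by simp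
    \<comment> \<open>In the limit the coefficients are the values \<open>f i \<omega>\<close>, and
      the inequality reads ?s^2 <= C ?s, from which ?s cancels unless it is 0.\<close>
    moreover have "(\<lambda>m. (\<Sum>i<n. q i m * f i \<omega>)\<^sup>2) \<longlonglongrightarrow> (\<Sum>i<n. f i \<omega> * f i \<omega>)\<^sup>2"
      "(\<lambda>m. C * (\<Sum>i<n. (q i m)\<^sup>2)) \<longlonglongrightarrow> C * ?s"
      by (intro tendsto_intros q)+
    ultimately have "(\<Sum>i<n. f i \<omega> * f i \<omega>)\<^sup>2 \<le> C * ?s" using LIMSEQ_le by blast
    hence "?s * ?s \<le> C * ?s" by (simp add: power2_eq_square)
    moreover have "?s \<ge> 0" by (intro sum_nonneg) auto
    ultimately show ?case using C(1) by (cases "?s = 0") auto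
  qed
  have int: "integrable M (\<lambda>\<omega>. (f i \<omega>)\<^sup>2)" if "i < n" for i
    using integrable_mult[OF fV fV, OF that that] by (simp add: power2_eq_square)
  have "real n = (\<Sum>i<n. \<integral>\<omega>. (f i \<omega>)\<^sup>2 \<partial>M)"
    using f by (simp add: orthonormal_def power2_eq_square)
  also have "\<dots> = (\<integral>\<omega>. (\<Sum>i<n. (f i \<omega>)\<^sup>2) \<partial>M)"
    using int by (subst Bochner_Integration.integral_sum) auto
  also have "\<dots> \<le> (\<integral>\<omega>. C \<partial>M)"
    using bd int by (intro integral_mono_AE) auto
  also have "\<dots> = C" by (simp add: prob_space)
  finally show ?thesis .
qed

text \<open>Dividing \<open>h\<close> by its L_2-norm gives the new member. For a family of greatest
  length this forces any residual orthogonal to it to have L_2-norm 0.\<close>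

lemma orthonormal_extend:
  assumes f: "orthonormal n f" and h: "h \<in> V" "(\<integral>\<omega>. (h \<omega>)\<^sup>2 \<partial>M) \<noteq> 0"
    and orth: "\<And>j. j < n \<Longrightarrow> (\<integral>\<omega>. h \<omega> * f j \<omega> \<partial>M) = 0"
  shows "\<exists>f'. orthonormal (Suc n) f'"
proof -
  define a where "a = sqrt (\<integral>\<omega>. (h \<omega>)\<^sup>2 \<partial>M)"
  have "(\<integral>\<omega>. (h \<omega>)\<^sup>2 \<partial>M) \<ge> 0" by simp
  hence a: "a \<noteq> 0" "a * a = (\<integral>\<omega>. h \<omega> * h \<omega> \<partial>M)"
    using h(2) by (auto simp: a_def power2_eq_square)
  define e where "e \<omega> = (1 / a) * h \<omega>" for \<omega>
  have e: "e \<in> V" unfolding e_def using h(1) by (rule scale_in)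
  have ee: "(\<integral>\<omega>. e \<omega> * e \<omega> \<partial>M) = 1" using a by (simp add: e_def flip: a(2))
  have ef: "(\<integral>\<omega>. e \<omega> * f j \<omega> \<partial>M) = 0" if "j < n" for j using orth[OF that] by (simp add: e_def)
  have fe: "(\<integral>\<omega>. f j \<omega> * e \<omega> \<partial>M) = 0" if "j < n" for j
    using ef[OF that] by (simp add: mult.commute)
  have "orthonormal (Suc n) (f(n := e))"
    using f e ee ef fe by (auto simp: orthonormal_def less_Suc_eq)
  thus ?thesis by blast
qed

text \<open>The size bound yields an orthonormal family of greatest length. What remains of
  \<open>g\<close> after subtracting its projection is orthogonal to the family, hence vanishes
  almost everywhere, as otherwise the family could be extended.\<close>

theorem finitely_spanned:
  "\<exists>(n::nat) f. (\<forall>i<n. f i \<in> V) \<and> (\<forall>g\<in>V. \<exists>c. AE \<omega> in M. g \<omega> = (\<Sum>i<n. c i * f i \<omega>))"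
proof -
  obtain C where C: "C > 0" "\<And>f. f \<in> V \<Longrightarrow> AE \<omega> in M. (f \<omega>)\<^sup>2 \<le> C * (\<integral>\<omega>. (f \<omega>)\<^sup>2 \<partial>M)"
    using ess_sup_le_L2 by blast
  let ?P = "\<lambda>n. \<exists>f. orthonormal n f"
  \<comment> \<open>The empty family ensures that some length occurs.\<close>
  have "?P 0" by (simp add: orthonormal_def)
  moreover have "n \<le> nat \<lfloor>C\<rfloor>" if "?P n" for n
    using orthonormal_card_le[OF C] that by (auto simp: le_nat_floor)
  ultimately have "\<exists>n. ?P n \<and> (\<forall>m. ?P m \<longrightarrow> m \<le> n)"
    using Nat.ex_has_greatest_nat[of ?P 0 "nat \<lfloor>C\<rfloor>"] by blast
  then obtain n f where f: "orthonormal n f" and max: "\<And>m. ?P m \<Longrightarrow> m \<le> n" by blast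
  have fV: "f i \<in> V" if "i < n" for i using f that by (simp add: orthonormal_def)
  have "\<exists>c. AE \<omega> in M. g \<omega> = (\<Sum>i<n. c i * f i \<omega>)" if g: "g \<in> V" for g
  proof -
    \<comment> \<open>\<open>c\<close> holds the Fourier coefficients of \<open>g\<close>,
      \<open>u\<close> is the projection onto the span, \<open>h\<close> the residual.\<close>
    define c where "c i = (\<integral>\<omega>. g \<omega> * f i \<omega> \<partial>M)" for i
    define u where "u \<omega> = (\<Sum>i<n. c i * f i \<omega>)" for \<omega>
    define h where "h \<omega> = g \<omega> - u \<omega>" for \<omega>
    have u: "u \<in> V" unfolding u_def using fV by (rule sum_in)
    have h: "h \<in> V" unfolding h_def using g u by (rule diff_in)
    have "(\<integral>\<omega>. h \<omega> * f j \<omega> \<partial>M) = 0" if "j < n" for j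
    proof -
      have "(\<integral>\<omega>. h \<omega> * f j \<omega> \<partial>M) = c j - (\<integral>\<omega>. u \<omega> * f j \<omega> \<partial>M)"
        using g u fV[OF that] by (simp add: h_def c_def left_diff_distrib integrable_mult)
      thus ?thesis using integral_sum_mult_orthonormal[OF f that] by (simp add: u_def)
    qed
    hence "(\<integral>\<omega>. (h \<omega>)\<^sup>2 \<partial>M) = 0"
      using orthonormal_extend[OF f h] max[of "Suc n"] by auto
    moreover have "integrable M (\<lambda>\<omega>. (h \<omega>)\<^sup>2)"
      using integrable_mult[OF h h] by (simp add: power2_eq_square)
    ultimately have "AE \<omega> in M. h \<omega> = 0"
      using integral_nonneg_eq_0_iff_AE[of M "\<lambda>\<omega>. (h \<omega>)\<^sup>2"] by simp
    hence "AE \<omega> in M. g \<omega> = (\<Sum>i<n. c i * f i \<omega>)" by (simp add: h_def u_def)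
    thus ?thesis by blast
  qed
  thus ?thesis using fV by blast
qed

end

section \<open>Return to almost-everywhere classes\<close>

lemma ae_class_eqD:
  assumes "f \<in> borel_measurable M" "ae_class M f = ae_class M g"
  shows "AE x in M. g x = f x"
proof -
  have "f \<in> ae_class M f" using assms(1) by (simp add: ae_class_def)
  thus ?thesis by (simp add: assms(2)) (simp add: ae_class_def)
qed

text \<open>\<open>K\<close> may depend on \<open>S\<close>, so a finite spanning set of
  \<open>S\<close> already yields it: the classes of the spanning functions of \<open>V\<close> span
  \<open>S\<close>.\<close>

theorem proposition3:
  fixes M :: "'a measure" and p :: real and S :: "('a \<Rightarrow> real) set set"
  assumes "prob_space M"
    and "p > 1" and "p \<noteq> 2"
    and "VectorSpace.subspace class_ring S (Lp M p)"
    and "closedin (Lp_topology M p) S"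
    and "S \<subseteq> Linf M"
  shows "\<exists>K::real. K > 0 \<and>
    vectorspace.fin_dim class_ring ((Lp M p)\<lparr>carrier := S\<rparr>) \<and>
    real (vectorspace.dim class_ring ((Lp M p)\<lparr>carrier := S\<rparr>)) \<le> K\<^sup>2"
proof -
  have p0: "p > 0" "p \<ge> 1" using assms(2) by auto
  interpret L: vectorspace class_ring "Lp M p" by (rule vectorspace_Lp[OF p0(1)])
  interpret D: Metric_space "carrier (Lp M p)" "Lp_dist M p" by (rule Metric_space_Lp[OF p0(2)])
  have sub: "submodule class_ring S (Lp M p)"
    using assms(4) by (simp add: VectorSpace.subspace_def)
  have S_sub: "S \<subseteq> carrier (Lp M p)" using sub by (simp add: submodule_def)
  \<comment> \<open>The full preimage of \<open>S\<close> among measurable functions, so that no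
    representative has to be chosen.\<close>
  define V where "V = {f \<in> borel_measurable M. ae_class M f \<in> S}"
  have V_int: "integrable M (\<lambda>x. \<bar>f x\<bar> powr p)" if "f \<in> V" for f
  proof -
    from that S_sub have "ae_class M f \<in> carrier (Lp M p)" by (auto simp: V_def)
    then obtain g where g: "ae_class M f = ae_class M g" "g \<in> borel_measurable M"
      "integrable M (\<lambda>x. \<bar>g x\<bar> powr p)" by (rule Lp_carrierE)
    have f: "f \<in> borel_measurable M" using that by (simp add: V_def)
    hence "AE x in M. g x = f x" using g(1) by (rule ae_class_eqD)
    hence "AE x in M. \<bar>g x\<bar> powr p = \<bar>f x\<bar> powr p" by eventually_elim simp
    thus ?thesis using g(2,3) f
      by (subst integrable_cong_AE[where g = "\<lambda>x. \<bar>g x\<bar> powr p"]) auto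
  qed
  interpret E: ess_bounded_Lp_subspace M p V
  proof (intro ess_bounded_Lp_subspace.intro ess_bounded_Lp_subspace_axioms.intro assms(1,2))
    show "f \<in> borel_measurable M" if "f \<in> V" for f using that by (simp add: V_def)
    show "\<exists>C. AE x in M. \<bar>f x\<bar> \<le> C" if "f \<in> V" for f
    proof -
      from that assms(6) obtain g C where g: "ae_class M f = ae_class M g" "AE x in M. \<bar>g x\<bar> \<le> C"
        by (auto simp: V_def Linf_def)
      have "AE x in M. g x = f x" using that by (intro ae_class_eqD[OF _ g(1)]) (simp add: V_def)
      with g(2) have "AE x in M. \<bar>f x\<bar> \<le> C" by eventually_elim simp
      thus ?thesis by blast
    qed
    show "(\<lambda>x. 0) \<in> V"
      using submodule.zero_closed[OF sub] by (simp add: V_def Lp_zero)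
    show "(\<lambda>x. f x + g x) \<in> V" if "f \<in> V" "g \<in> V" for f g
      using that submodule.m_closed[OF sub] by (auto simp: V_def Lp_add_class[symmetric, where p = p])
    show "(\<lambda>x. c * f x) \<in> V" if "f \<in> V" for c f
      using that submodule.smult_closed[OF sub] by (auto simp: V_def Lp_smult_class[symmetric, where p = p])
    \<comment> \<open>Taking p-th roots turns the convergence of integrals into convergence in the
      metric of L_p, where topological closedness of \<open>S\<close> applies.\<close>
    show "f \<in> V" if X: "\<And>k. X k \<in> V" and f: "f \<in> borel_measurable M"
      and i: "integrable M (\<lambda>x. \<bar>f x\<bar> powr p)"
      and lim: "(\<lambda>k. \<integral>x. \<bar>X k x - f x\<bar> powr p \<partial>M) \<longlonglongrightarrow> 0" for X f
    proof -
      have "Lp_dist M p (ae_class M (X k)) (ae_class M f) =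
          (\<integral>x. \<bar>X k x - f x\<bar> powr p \<partial>M) powr (1 / p)" for k
        using X V_int f i p0 by (intro Lp_dist_class) (auto simp: V_def)
      moreover have "(\<lambda>k. (\<integral>x. \<bar>X k x - f x\<bar> powr p \<partial>M) powr (1 / p)) \<longlonglongrightarrow> 0"
        using p0 by (intro tendsto_zero_powrI[OF lim tendsto_const]) auto
      ultimately have "limitin D.mtopology (\<lambda>k. ae_class M (X k)) (ae_class M f) sequentially"
        using X S_sub f i by (subst D.limitin_metric_dist_null)
          (auto simp: V_def subset_iff intro: Lp_carrierI always_eventually)
      hence "ae_class M f \<in> S"
        using X assms(5) by (intro limitin_closedin) (auto simp: V_def Lp_topology_def)
      thus ?thesis using f by (simp add: V_def)
    qed
  qed
  interpret W: vectorspace class_ring "(Lp M p)\<lparr>carrier := S\<rparr>"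
    using L.subspace_is_vs[OF assms(4)] by simp
  obtain n :: nat and f where f: "\<And>i. i < n \<Longrightarrow> f i \<in> V"
    and span: "\<And>g. g \<in> V \<Longrightarrow> \<exists>c. AE x in M. g x = (\<Sum>i<n. c i * f i x)"
    using E.finitely_spanned by blast
  define A where "A = (\<lambda>i. ae_class M (f i)) ` {..<n}"
  have A: "finite A" "A \<subseteq> S" using f by (auto simp: A_def V_def)
  have sp: "submodule class_ring (W.span A) ((Lp M p)\<lparr>carrier := S\<rparr>)"
    using A by (intro W.span_is_submodule) auto
  have fm: "f i \<in> borel_measurable M" if "i < n" for i using f[OF that] by (simp add: V_def)
  \<comment> \<open>Induction on the length of the partial sum, using that the span is closed under
    binary sums and scalar multiples.\<close>
  have comb: "ae_class M (\<lambda>x. \<Sum>i<m. c i * f i x) \<in> W.span A" if "m \<le> n" for m c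
    using that
  proof (induction m)
    case 0
    show ?case using submodule.zero_closed[OF sp] by (simp add: Lp_zero)
  next
    case (Suc m)
    hence m: "m < n" by simp
    have meas: "(\<lambda>x. \<Sum>i<m. c i * f i x) \<in> borel_measurable M"
      using fm m by (intro borel_measurable_sum borel_measurable_times) auto
    have "ae_class M (f m) \<in> W.span A"
      using W.in_own_span[of A] A m by (auto simp: A_def)
    hence "ae_class M (\<lambda>x. c m * f m x) \<in> W.span A"
      using submodule.smult_closed[OF sp, of "c m" "ae_class M (f m)"] fm[OF m] by (simp add: Lp_smult_class)
    moreover have "ae_class M (\<lambda>x. \<Sum>i<m. c i * f i x) \<in> W.span A" using Suc by simp
    ultimately show ?case
      using submodule.m_closed[OF sp, of "ae_class M (\<lambda>x. \<Sum>i<m. c i * f i x)" "ae_class M (\<lambda>x. c m * f m x)"]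
        meas fm[OF m] by (simp add: Lp_add_class)
  qed
  have "S \<subseteq> W.span A"
  proof
    fix u assume u: "u \<in> S"
    with S_sub have "u \<in> carrier (Lp M p)" by blast
    then obtain g where g: "u = ae_class M g" "g \<in> borel_measurable M"
      by (rule Lp_carrierE)
    then obtain c where "AE x in M. g x = (\<Sum>i<n. c i * f i x)"
      using span[of g] u by (auto simp: V_def)
    hence "u = ae_class M (\<lambda>x. \<Sum>i<n. c i * f i x)" unfolding g(1) by (rule ae_class_eq)
    thus "u \<in> W.span A" using comb[of n c] by simp
  qed
  moreover have "W.span A \<subseteq> S" using W.span_is_subset2[of A] A by simp
  ultimately have "W.fin_dim"
    unfolding W.fin_dim_def using A by (intro exI[of _ A]) auto
  \<comment> \<open>Adding 1 keeps the constant positive even in dimension 0.\<close>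
  moreover have "real W.dim \<le> (real W.dim + 1)\<^sup>2" by (simp add: power2_eq_square algebra_simps)
  ultimately show ?thesis by (intro exI[of _ "real W.dim + 1"]) auto
qed

end
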